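(* Let $\mathbf{M},\mathbf{B}\in\mathbb{R}^{n\times p}$, let $\mathbf{V}=(v_{ij})\in\mathbb{R}^{p\times p}$ and $\boldsymbol{\Sigma}=(\sigma_{ij})\in\mathbb{R}^{n\times n}$ be positive definite, and let $\boldsymbol{Z}\sim SN_{n\times p}(\mathbf{M},\mathbf{V}\otimes\boldsymbol{\Sigma},\mathbf{B})$. Put $\mathbf{v}=\mathrm{diag}\{\sqrt{v_{11}},\dots,\sqrt{v_{pp}}\}$, $\boldsymbol{\sigma}=\mathrm{diag}\{\sqrt{\sigma_{11}},\dots,\sqrt{\sigma_{nn}}\}$, $\overline{\mathbf{V}}=\mathbf{v}^{-1}\mathbf{V}\mathbf{v}^{-1}$ and $\overline{\boldsymbol{\Sigma}}=\boldsymbol{\sigma}^{-1}\boldsymbol{\Sigma}\boldsymbol{\sigma}^{-1}$. Then the characteristic function of $\boldsymbol{Z}$ is, for $\mathbf{T}\in\mathbb{R}^{n\times p}$, $$\Psi_Z(\mathbf{T})=2\,\mathrm{etr}\left(i\mathbf{M}^T\mathbf{T}-\frac12\mathbf{T}^T\boldsymbol{\Sigma}\mathbf{T}\mathbf{V}\right)\Phi\left(i\,\frac{\mathrm{tr}\left(\mathbf{V}\mathbf{v}^{-1}\mathbf{B}^T\boldsymbol{\sigma}^{-1}\boldsymbol{\Sigma}\mathbf{T}\right)}{\sqrt{1+\mathrm{tr}\left(\mathbf{B}^T\overline{\boldsymbol{\Sigma}}\mathbf{B}\overline{\mathbf{V}}\right)}}\right),$$ where $i=\sqrt{-1}$.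
   Context: Notation: $\mathrm{vec}$ stacks the columns of a matrix into one column vector, $\otimes$ is the Kronecker product, $\mathrm{tr}$ is the trace and $\mathrm{etr}(\mathbf{A})=\exp(\mathrm{tr}\,\mathbf{A})$. $\Phi$ is the standard normal distribution function, extended to complex arguments as the entire function $\Phi(z)=\frac12+\frac1{\sqrt{2\pi}}\int_0^z e^{-s^2/2}\,ds$; in particular, for real $u$, $2\Phi(iu)=1+i\tau(u)$ with $\tau(u)=\sqrt{2/\pi}\int_0^u e^{s^2/2}\,ds$. Matrix variate skew-normal distribution: $\boldsymbol{Z}\sim SN_{n\times p}(\mathbf{M},\mathbf{V}\otimes\boldsymbol{\Sigma},\mathbf{B})$ means that the $n\times p$ random matrix $\boldsymbol{Z}$ has density $$f(\mathbf{Z})=2\,\phi_{n\times p}(\mathbf{Z};\mathbf{M},\mathbf{V}\otimes\boldsymbol{\Sigma})\,\Phi\left(\mathrm{vec}(\mathbf{B})^T\boldsymbol{\omega}^{-1}\mathrm{vec}(\mathbf{Z}-\mathbf{M})\right),\qquad \boldsymbol{\omega}=\mathbf{v}\otimes\boldsymbol{\sigma},$$ where $\phi_{n\times p}(\cdot;\mathbf{M},\mathbf{V}\otimes\boldsymbol{\Sigma})$ is the density of the matrix variate normal distribution, i.e. of a random matrix $\boldsymbol{N}$ with $\mathrm{vec}(\boldsymbol{N})\sim N_{np}(\mathrm{vec}(\mathbf{M}),\mathbf{V}\otimes\boldsymbol{\Sigma})$. The characteristic function of an $n\times p$ random matrix $\boldsymbol{Z}$ is $\Psi_Z(\mathbf{T})=E[\mathrm{etr}(i\mathbf{T}^T\boldsymbol{Z})]$,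 $\mathbf{T}\in\mathbb{R}^{n\times p}$. *)

theory Defs
  imports "HOL-Probability.Probability" "HOL-Complex_Analysis.Complex_Analysis"
begin

section \<open>Matrices\<close>

text \<open>An n by p real matrix has type \<open>real^'p^'n\<close>, its (i, j) entry being \<open>A $ i $ j\<close>.\<close>

definition positive_definite :: "real^'n^'n \<Rightarrow> bool" where
  "positive_definite A \<longleftrightarrow> transpose A = A \<and> (\<forall>x. x \<noteq> 0 \<longrightarrow> x \<bullet> (A *v x) > 0)"

definition diag_matrix :: "'a::zero^'n \<Rightarrow> 'a^'n^'n" where
  "diag_matrix d = (\<chi> i j. if i = j then d $ i else 0)"

text \<open>Column stacking. The stacked vector is indexed by pairs (column, row), so that the
  lexicographic order of the index pairs is the usual order of the entries; the Kronecker
  product below uses the same convention (block index first).\<close>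

definition vec_cols :: "'a^'p^'n \<Rightarrow> 'a^('p \<times> 'n)" where
  "vec_cols A = (\<chi> k. A $ snd k $ fst k)"

definition kronecker ::
  "'a::times^'q^'p \<Rightarrow> 'a^'m^'n \<Rightarrow> 'a^('q \<times> 'm)^('p \<times> 'n)" (infixl \<open>\<otimes>\<^sub>K\<close> 75) where
  "A \<otimes>\<^sub>K C = (\<chi> k l. A $ fst k $ fst l * C $ snd k $ snd l)"

definition cmatrix :: "real^'p^'n \<Rightarrow> complex^'p^'n" where
  "cmatrix A = map_matrix complex_of_real A"

definition mscale :: "'a::times \<Rightarrow> 'a^'p^'n \<Rightarrow> 'a^'p^'n" (infixr \<open>*\<^sub>m\<close> 75) where
  "c *\<^sub>m A = map_matrix ((*) c) A"

definition etr :: "complex^'n^'n \<Rightarrow> complex" where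
  "etr A = exp (trace A)"


section \<open>The standard normal distribution function\<close>

definition std_normal_cdf :: "real \<Rightarrow> real" where
  "std_normal_cdf = cdf std_normal_distribution"

text \<open>The entire extension of \<open>std_normal_cdf\<close>; see \<open>Phi_entire\<close> and \<open>Phi_of_real\<close> below.\<close>

definition Phi :: "complex \<Rightarrow> complex" where
  "Phi z = 1/2 + 1 / complex_of_real (sqrt (2 * pi)) *
     contour_integral (linepath 0 z) (\<lambda>s. exp (- s\<^sup>2 / 2))"

lemma Phi_has_field_derivative:
  "(Phi has_field_derivative 1 / complex_of_real (sqrt (2 * pi)) * exp (- z\<^sup>2 / 2)) (at z)"
proof -
  have "(\<lambda>s::complex. exp (- s\<^sup>2 / 2)) holomorphic_on UNIV"
    by (intro holomorphic_intros) auto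
  then obtain g where
      g: "\<And>x::complex. (g has_field_derivative exp (- x\<^sup>2 / 2)) (at x)"
    using holomorphic_convex_primitive'[of UNIV "\<lambda>s::complex. exp (- s\<^sup>2 / 2)"] by auto
  have "contour_integral (linepath 0 w) (\<lambda>s. exp (- s\<^sup>2 / 2)) = g w - g 0" for w
    using contour_integral_primitive[of UNIV g "\<lambda>s. exp (- s\<^sup>2 / 2)" "linepath 0 w"] g
    by (intro contour_integral_unique) simp
  then have Phi_eq: "Phi = (\<lambda>w. 1/2 + 1 / complex_of_real (sqrt (2 * pi)) * (g w - g 0))"
    by (auto simp: Phi_def)
  show ?thesis
    unfolding Phi_eq by (auto intro!: derivative_eq_intros g)
qed

lemma Phi_entire: "Phi holomorphic_on UNIV"
  using Phi_has_field_derivative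
  by (auto simp: holomorphic_on_def field_differentiable_def)

lemma measure_std_normal:
  assumes [measurable]: "A \<in> sets borel"
  shows "measure std_normal_distribution A = (\<integral>x. std_normal_density x * indicator A x \<partial>lborel)"
proof -
  interpret N: real_distribution std_normal_distribution
    by (rule real_dist_normal_dist)
  have "measure std_normal_distribution A = (\<integral>x. indicator A x \<partial>std_normal_distribution)"
    by simp
  also have "\<dots> = (\<integral>x. std_normal_density x *\<^sub>R indicator A x \<partial>lborel)"
    by (rule integral_density) auto
  finally show ?thesis by simp
qed

lemma std_normal_cdf_0: "std_normal_cdf 0 = 1 / 2"
proof -
  interpret N: real_distribution std_normal_distribution
    by (rule real_dist_normal_dist)
  have "measure std_normal_distribution {..0}
      = (\<integral>x. std_normal_density x * indicator {..0} x \<partial>lborel)"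
    by (rule measure_std_normal) simp
  also have "\<dots> = (\<integral>x. std_normal_density (- x) * indicator {..0} (- x) \<partial>lborel)"
    using lborel_integral_real_affine[of "-1"
        "\<lambda>x. std_normal_density x * indicator {..0} x" 0] by simp
  also have "\<dots> = (\<integral>x. std_normal_density x * indicator {0<..} x \<partial>lborel)"
  proof (rule integral_cong_AE)
    show "AE x in lborel. std_normal_density (- x) * indicator {..0} (- x)
        = std_normal_density x * indicator {0<..} x"
      using AE_lborel_singleton[of 0]
      by eventually_elim (auto simp: indicator_def std_normal_density_def)
  qed measurable
  also have "\<dots> = measure std_normal_distribution {0<..}"
    by (rule measure_std_normal[symmetric]) simp
  also have "{0<..} = space std_normal_distribution - {..0::real}"
    by auto
  also have "measure std_normal_distribution \<dots> = 1 - measure std_normal_distribution {..0}"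
    by (rule N.prob_compl) simp
  finally show ?thesis
    by (simp add: std_normal_cdf_def cdf_def)
qed

lemma Phi_diff_of_real:
  assumes "a \<le> b"
  shows "Phi (of_real b) - Phi (of_real a) = complex_of_real (std_normal_cdf b - std_normal_cdf a)"
proof -
  interpret N: real_distribution std_normal_distribution
    by (rule real_dist_normal_dist)
  have D: "((\<lambda>x. Phi (complex_of_real x)) has_vector_derivative
              complex_of_real (std_normal_density x)) (at x within {a..b})" for x
  proof -
    have "(complex_of_real has_vector_derivative 1) (at x within {a..b})"
      using has_vector_derivative_of_real[OF DERIV_ident] by simp
    from field_vector_diff_chain_within[OF this
        has_field_derivative_at_within[OF Phi_has_field_derivative]]
    show ?thesis
      by (simp add: o_def std_normal_density_def exp_of_real[symmetric])
  qed
  have "(\<integral>x. indicator {a..b} x *\<^sub>R complex_of_real (std_normal_density x) \<partial>lborel)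
      = Phi (of_real b) - Phi (of_real a)"
    by (rule integral_FTC_Icc[OF assms D])
      (auto intro!: continuous_intros simp: std_normal_density_def)
  also have "(\<integral>x. indicator {a..b} x *\<^sub>R complex_of_real (std_normal_density x) \<partial>lborel)
      = (\<integral>x. complex_of_real (std_normal_density x * indicator {a<..b} x) \<partial>lborel)"
  proof (rule integral_cong_AE)
    show "AE x in lborel. indicator {a..b} x *\<^sub>R complex_of_real (std_normal_density x)
        = complex_of_real (std_normal_density x * indicator {a<..b} x)"
      using AE_lborel_singleton[of a]
      by eventually_elim (auto simp: indicator_def)
  qed measurable
  also have "\<dots> = complex_of_real (\<integral>x. std_normal_density x * indicator {a<..b} x \<partial>lborel)"
    by (rule integral_complex_of_real)
  also have "(\<integral>x. std_normal_density x * indicator {a<..b} x \<partial>lborel)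
      = measure std_normal_distribution {a<..b}"
    by (rule measure_std_normal[symmetric]) simp
  also have "\<dots> = std_normal_cdf b - std_normal_cdf a"
    using assms by (cases "a = b") (auto simp: std_normal_cdf_def N.cdf_diff_eq)
  finally show ?thesis by simp
qed

lemma Phi_of_real: "Phi (of_real x) = of_real (std_normal_cdf x)"
proof -
  have 0: "Phi (of_real 0) = of_real (std_normal_cdf 0)"
    by (simp add: Phi_def std_normal_cdf_0)
  show ?thesis
  proof (cases "0 \<le> x")
    case True
    from Phi_diff_of_real[OF this] show ?thesis
      unfolding 0 of_real_diff by simp
  next
    case False
    then have "x \<le> 0" by simp
    from Phi_diff_of_real[OF this] show ?thesis
      unfolding 0 of_real_diff by simp
  qed
qed


section \<open>Matrix variate normal and skew-normal distributions\<close>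

definition mvnormal_density :: "real^'k \<Rightarrow> real^'k^'k \<Rightarrow> real^'k \<Rightarrow> real" where
  "mvnormal_density \<mu> \<Omega> x =
     exp (- ((x - \<mu>) \<bullet> (matrix_inv \<Omega> *v (x - \<mu>))) / 2) / sqrt ((2 * pi) ^ CARD('k) * det \<Omega>)"

text \<open>The covariance \<open>\<Omega>\<close> is that of the stacked vector.\<close>

definition matrix_normal_density ::
  "real^'p^'n \<Rightarrow> real^('p \<times> 'n)^('p \<times> 'n) \<Rightarrow> real^'p^'n \<Rightarrow> real" where
  "matrix_normal_density M \<Omega> Z = mvnormal_density (vec_cols M) \<Omega> (vec_cols Z)"

definition sd_matrix :: "real^'n^'n \<Rightarrow> real^'n^'n" where
  "sd_matrix A = diag_matrix (\<chi> i. sqrt (A $ i $ i))"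

definition skew_normal_density ::
  "real^'p^'n \<Rightarrow> real^'p^'p \<Rightarrow> real^'n^'n \<Rightarrow> real^'p^'n \<Rightarrow> real^'p^'n \<Rightarrow> real" where
  "skew_normal_density M V \<Sigma> B Z =
     2 * matrix_normal_density M (V \<otimes>\<^sub>K \<Sigma>) Z *
     std_normal_cdf (vec_cols B \<bullet>
       (matrix_inv (sd_matrix V \<otimes>\<^sub>K sd_matrix \<Sigma>) *v vec_cols (Z - M)))"

text \<open>\<open>lborel\<close> on \<open>real^'p^'n\<close> is Lebesgue measure in the matrix entries.\<close>

definition skew_normal_distributed ::
  "'w measure \<Rightarrow> ('w \<Rightarrow> real^'p^'n) \<Rightarrow> real^'p^'n \<Rightarrow> real^'p^'p \<Rightarrow> real^'n^'n \<Rightarrow> real^'p^'n \<Rightarrow> bool"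
where
  "skew_normal_distributed P Z M V \<Sigma> B \<longleftrightarrow>
     distributed P lborel Z (\<lambda>z. ennreal (skew_normal_density M V \<Sigma> B z))"

definition matrix_char :: "'w measure \<Rightarrow> ('w \<Rightarrow> real^'p^'n) \<Rightarrow> real^'p^'n \<Rightarrow> complex" where
  "matrix_char P Z T = (\<integral>w. etr (\<i> *\<^sub>m cmatrix (transpose T ** Z w)) \<partial>P)"

end

theory Submission
  imports Defs
begin

text \<open>A centred Gaussian measure \<open>N\<close> with covariance operator \<open>S\<close> is characterised by the
  Cameron--Martin formula: translating \<open>N\<close> by \<open>S u\<close> multiplies it by the density
  \<open>exp (u \<bullet> y - u \<bullet> S u / 2)\<close>. For a measure with density proportional to \<open>exp (- q y / 2)\<close>, where
  \<open>q\<close> is the quadratic form inverse to \<open>S\<close>, this is completing the square together with the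
  translation invariance of Lebesgue measure. All further properties of \<open>N\<close> are
  deduced from this formula.

  Let \<open>Y\<close> have distribution \<open>N\<close>. Since \<open>Y\<close> weighted by \<open>exp (t \<bullet> y)\<close> is \<open>Y + S t\<close> up to the factor \<open>exp (t \<bullet> S t / 2)\<close>,
  the real exponential transform of \<open>std_normal_cdf (a \<bullet> Y)\<close> at \<open>t\<close> is that factor times the mean of
  \<open>std_normal_cdf (a \<bullet> Y + a \<bullet> S t)\<close>. This mean is the probability that
  \<open>W - a \<bullet> Y \<le> a \<bullet> S t\<close> for an independent standard normal \<open>W\<close>, and \<open>W - a \<bullet> Y\<close> is normal with
  variance \<open>1 + a \<bullet> S a\<close> (\<open>integral_std_normal_cdf_inner\<close>). Replacing \<open>t\<close> by \<open>z t\<close> for real \<open>z\<close>,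
  both sides of the resulting identity are restrictions of entire functions of \<open>z\<close>
  (\<open>exp_integral_entire\<close>); at \<open>z = \<i>\<close> it becomes the characteristic function
  (\<open>integral_std_normal_cdf_iexp\<close>).

  For matrices, \<open>S U = \<Sigma> ** U ** V\<close> corresponds to \<open>V \<otimes>\<^sub>K \<Sigma>\<close> under column stacking. The total mass
  of the normal density is obtained from that of the skew-normal density: the two skewing factors at
  \<open>y\<close> and \<open>- y\<close> add up to one, so symmetrising the skew-normal density leaves the normal one
  (\<open>skew_density_normalised\<close>).\<close>


section \<open>The standard normal distribution function\<close>

lemma std_normal_cdf_measurable [measurable]: "std_normal_cdf \<in> borel_measurable borel"
proof -
  interpret G: real_distribution std_normal_distribution
    by (rule real_dist_normal_dist)
  show ?thesis
    unfolding std_normal_cdf_def by (intro borel_measurable_mono monoI G.cdf_nondecreasing)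
qed

lemma std_normal_cdf_nonneg: "0 \<le> std_normal_cdf x"
  by (simp add: std_normal_cdf_def cdf_def)

lemma std_normal_cdf_le_1: "std_normal_cdf x \<le> 1"
proof -
  interpret G: real_distribution std_normal_distribution
    by (rule real_dist_normal_dist)
  show ?thesis
    unfolding std_normal_cdf_def by (rule G.cdf_bounded_prob)
qed

text \<open>The function \<open>Phi z + Phi (- z)\<close> has derivative zero because the derivative of \<open>Phi\<close> is even.\<close>

lemma std_normal_cdf_uminus: "std_normal_cdf (- x) = 1 - std_normal_cdf x"
proof -
  have "((\<lambda>z. Phi z + Phi (- z)) has_field_derivative 0) (at z)" for z
    using DERIV_add[OF Phi_has_field_derivative[of z]
        DERIV_chain'[OF DERIV_minus[OF DERIV_ident] Phi_has_field_derivative[of "- z"]]]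
    by simp
  then obtain c where c: "\<And>z. Phi z + Phi (- z) = c"
    using has_field_derivative_zero_constant[of UNIV "\<lambda>z. Phi z + Phi (- z)"] by auto
  have "Phi (of_real x) + Phi (of_real (- x)) = Phi (of_real 0) + Phi (of_real 0)"
    using c[of "of_real x"] c[of 0] by simp
  then have "complex_of_real (std_normal_cdf x + std_normal_cdf (- x)) = complex_of_real 1"
    unfolding Phi_of_real std_normal_cdf_0 by simp
  then show ?thesis
    unfolding of_real_eq_iff by simp
qed


section \<open>Entire functions given by exponential integrals\<close>

text \<open>The exponential series converges absolutely, so the bound holds for every finite set of terms.
  Single terms and initial segments are the cases of interest: they make the dominated
  convergence argument below uniform in the number of terms.\<close>

lemma norm_exp_sum_le:
  fixes w :: complex
  assumes "finite I"
  shows "norm (\<Sum>k\<in>I. w ^ k / fact k) \<le> exp (norm w)"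
proof -
  have s: "(\<lambda>k. norm w ^ k / fact k) sums exp (norm w)"
    using exp_converges[of "norm w"] by (simp add: divide_inverse ac_simps)
  have "norm (\<Sum>k\<in>I. w ^ k / fact k) \<le> (\<Sum>k\<in>I. norm w ^ k / fact k)"
    by (rule order_trans[OF norm_sum]) (simp add: norm_divide norm_power)
  also have "\<dots> \<le> exp (norm w)"
    unfolding sums_unique[OF s] by (rule sum_le_suminf[OF sums_summable[OF s] assms]) auto
  finally show ?thesis .
qed

text \<open>Integrating the exponential series term by term exhibits the integral as a power series in \<open>z\<close>
  with infinite radius of convergence. The dominating function is \<open>exp (norm z * \<bar>X x\<bar>)\<close> up to a
  constant, which is at most the sum of the two real exponentials with exponents \<open>\<plusminus> norm z * X x\<close>.\<close>

lemma exp_integral_entire: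
  fixes X :: "'a \<Rightarrow> real" and g :: "'a \<Rightarrow> complex"
  assumes X [measurable]: "X \<in> borel_measurable N" and g [measurable]: "g \<in> borel_measurable N"
    and bounded: "\<And>x. norm (g x) \<le> K"
    and expint: "\<And>r. integrable N (\<lambda>x. exp (r * X x))"
  shows "(\<lambda>z. \<integral>x. g x * exp (z * of_real (X x)) \<partial>N) holomorphic_on UNIV"
proof -
  have K: "0 \<le> K"
    using order_trans[OF norm_ge_zero bounded] .
  have absint: "integrable N (\<lambda>x. K * exp (r * \<bar>X x\<bar>))" for r
  proof (rule Bochner_Integration.integrable_bound)
    show "integrable N (\<lambda>x. K * (exp (r * X x) + exp ((-r) * X x)))"
      by (intro integrable_mult_right Bochner_Integration.integrable_add expint)
    show "AE x in N. norm (K * exp (r * \<bar>X x\<bar>)) \<le> norm (K * (exp (r * X x) + exp ((-r) * X x)))"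
    proof (rule AE_I2)
      fix x
      have "exp (r * \<bar>X x\<bar>) \<le> exp (r * X x) + exp ((-r) * X x)"
        by (cases "0 \<le> X x") auto
      moreover have "0 < exp (r * X x) + exp ((-r) * X x)"
        by (intro add_pos_pos) auto
      ultimately show "norm (K * exp (r * \<bar>X x\<bar>)) \<le> norm (K * (exp (r * X x) + exp ((-r) * X x)))"
        using K by (simp add: abs_mult mult_left_mono del: mult_minus_left)
    qed
  qed measurable
  have dom: "integrable N (\<lambda>x. K * exp (norm (z * complex_of_real (X x))))" for z
    using absint[of "norm z"] by (simp add: norm_mult)
  have le: "norm (g x * w) \<le> norm (K * exp r)" if "norm w \<le> exp r" for x w r
    using that K bounded[of x] by (simp add: norm_mult abs_mult mult_mono)
  define a where "a n = (\<integral>x. g x * (of_real (X x) ^ n / fact n) \<partial>N)" for n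
  have sums: "(\<lambda>n. a n * z ^ n) sums (\<integral>x. g x * exp (z * of_real (X x)) \<partial>N)" for z
  proof -
    have int: "integrable N (\<lambda>x. g x * ((z * of_real (X x)) ^ n / fact n))" for n
      by (rule Bochner_Integration.integrable_bound[OF dom[of z]])
        (auto intro!: AE_I2 le norm_exp_sum_le[of "{_}", simplified]
          simp del: norm_mult norm_divide times_divide_eq_right real_norm_def)
    have "(\<lambda>n. \<integral>x. g x * (\<Sum>k<n. (z * of_real (X x)) ^ k / fact k) \<partial>N)
        \<longlonglongrightarrow> (\<integral>x. g x * exp (z * of_real (X x)) \<partial>N)"
    proof (rule integral_dominated_convergence[OF _ _ dom[of z]])
      show "AE x in N. (\<lambda>n. g x * (\<Sum>k<n. (z * of_real (X x)) ^ k / fact k))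
          \<longlonglongrightarrow> g x * exp (z * of_real (X x))"
      proof (intro AE_I2 tendsto_intros)
        fix x
        show "(\<lambda>n. \<Sum>k<n. (z * complex_of_real (X x)) ^ k / fact k) \<longlonglongrightarrow> exp (z * of_real (X x))"
          using exp_converges[of "z * complex_of_real (X x)"]
          by (simp add: sums_def scaleR_conv_of_real divide_inverse ac_simps)
      qed
      show "AE x in N. norm (g x * (\<Sum>k<n. (z * of_real (X x)) ^ k / fact k))
          \<le> K * exp (norm (z * complex_of_real (X x)))" for n
      proof (rule AE_I2)
        fix x
        show "norm (g x * (\<Sum>k<n. (z * of_real (X x)) ^ k / fact k))
            \<le> K * exp (norm (z * complex_of_real (X x)))"
          using le[OF norm_exp_sum_le[OF finite_lessThan, of "z * complex_of_real (X x)" n], of x]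
          unfolding real_norm_def abs_of_nonneg[OF mult_nonneg_nonneg[OF K exp_ge_zero]] .
      qed
    qed measurable
    also have "(\<lambda>n. \<integral>x. g x * (\<Sum>k<n. (z * of_real (X x)) ^ k / fact k) \<partial>N)
        = (\<lambda>n. \<Sum>k<n. a k * z ^ k)"
    proof
      fix n
      have "(\<integral>x. g x * (\<Sum>k<n. (z * of_real (X x)) ^ k / fact k) \<partial>N)
          = (\<Sum>k<n. \<integral>x. g x * ((z * of_real (X x)) ^ k / fact k) \<partial>N)"
        unfolding sum_distrib_left by (rule Bochner_Integration.integral_sum) (rule int)
      also have "\<dots> = (\<Sum>k<n. \<integral>x. z ^ k * (g x * (of_real (X x) ^ k / fact k)) \<partial>N)"
        by (simp add: power_mult_distrib ac_simps)
      also have "\<dots> = (\<Sum>k<n. a k * z ^ k)"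
        by (simp add: a_def mult.commute[of _ "z ^ _"])
      finally show "(\<integral>x. g x * (\<Sum>k<n. (z * of_real (X x)) ^ k / fact k) \<partial>N) = (\<Sum>k<n. a k * z ^ k)" .
    qed
    finally show ?thesis
      by (simp add: sums_def)
  qed
  have "(\<lambda>z. \<integral>x. g x * exp (z * of_real (X x)) \<partial>N) holomorphic_on ball 0 r" for r
    by (rule power_series_holomorphic[of 0 r a]) (simp add: sums)
  then have "(\<lambda>z. \<integral>x. g x * exp (z * of_real (X x)) \<partial>N) holomorphic_on (\<Union>r. ball 0 r)"
    by (intro holomorphic_on_UN_open) auto
  moreover have "(\<Union>r. ball (0::complex) r) = UNIV"
    by (auto intro: gt_ex)
  ultimately show ?thesis
    by simp
qed

text \<open>The reals accumulate at 0, so this is an instance of the identity theorem.\<close>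

lemma entire_eqI_reals:
  assumes "f holomorphic_on UNIV" "h holomorphic_on UNIV"
    and "\<And>r::real. f (of_real r) = h (of_real r)"
  shows "f z = h z"
proof -
  have "(0::complex) islimpt range complex_of_real"
  proof (rule islimptI)
    fix U :: "complex set" assume "0 \<in> U" "open U"
    then obtain e where "e > 0" "ball 0 e \<subseteq> U"
      using open_contains_ball by blast
    then have "complex_of_real (e / 2) \<in> U"
      by (auto simp: subset_iff)
    with \<open>e > 0\<close> show "\<exists>y\<in>range complex_of_real. y \<in> U \<and> y \<noteq> 0"
      by (intro bexI[of _ "complex_of_real (e / 2)"]) (auto simp del: of_real_divide)
  qed
  then have "f z - h z = 0"
    using assms
    by (intro analytic_continuation[of "\<lambda>z. f z - h z" UNIV "range complex_of_real" 0 z])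
      (auto intro!: holomorphic_intros)
  then show ?thesis
    by simp
qed


section \<open>Centred Gaussian measures\<close>

text \<open>The assumption \<open>shift\<close> is the Cameron--Martin formula. It determines the centred Gaussian measure
  with covariance operator \<open>S\<close>, degenerate ones included, without reference to a density.\<close>

locale cameron_martin = prob_space N
  for N :: "'a::euclidean_space measure" +
  fixes S :: "'a \<Rightarrow> 'a"
  assumes sets_N [measurable_cong]: "sets N = sets borel"
    and linear_S: "linear S"
    and shift: "distr N borel (\<lambda>y. y + S u) = density N (\<lambda>y. ennreal (exp (u \<bullet> y - u \<bullet> S u / 2)))"
begin

text \<open>Both integrals are, up to the constant factor, the integral of \<open>g\<close> with respect to the measure
  that \<open>shift\<close> describes in two ways.\<close>

lemma integral_exp_inner:
  fixes g :: "'a \<Rightarrow> complex"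
  assumes [measurable]: "g \<in> borel_measurable borel"
  shows "(\<integral>y. g y * of_real (exp (u \<bullet> y)) \<partial>N) = of_real (exp (u \<bullet> S u / 2)) * (\<integral>y. g (y + S u) \<partial>N)"
proof -
  have "(\<integral>y. g (y + S u) \<partial>N) = (\<integral>y. g y \<partial>distr N borel (\<lambda>y. y + S u))"
    by (rule integral_distr[symmetric]) measurable
  also have "\<dots> = (\<integral>y. exp (u \<bullet> y - u \<bullet> S u / 2) *\<^sub>R g y \<partial>N)"
    unfolding shift by (rule integral_density) measurable
  also have "\<dots> = (\<integral>y. of_real (exp (- (u \<bullet> S u / 2))) * (g y * of_real (exp (u \<bullet> y))) \<partial>N)"
    by (intro Bochner_Integration.integral_cong refl)
      (simp add: scaleR_conv_of_real mult.left_commute flip: of_real_mult exp_add)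
  also have "\<dots> = of_real (exp (- (u \<bullet> S u / 2))) * (\<integral>y. g y * of_real (exp (u \<bullet> y)) \<partial>N)"
    by simp
  finally show ?thesis
    by (simp add: exp_minus)
qed

text \<open>The weighted measure in \<open>shift\<close> is a translate of \<open>N\<close> and hence has total mass one.\<close>

lemma integrable_exp_inner: "integrable N (\<lambda>y. exp (u \<bullet> y))"
proof -
  have "prob_space (distr N borel (\<lambda>y. y + S u))"
    by (rule prob_space_distr) measurable
  then have "emeasure (density N (\<lambda>y. ennreal (exp (u \<bullet> y - u \<bullet> S u / 2)))) (space N) = 1"
    unfolding shift using prob_space.emeasure_space_1 by force
  then have "(\<integral>\<^sup>+y. ennreal (exp (u \<bullet> y - u \<bullet> S u / 2)) \<partial>N) = 1"
    by (subst (asm) emeasure_density) (auto simp: sets.sets_into_space cong: nn_integral_cong)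
  then have "integrable N (\<lambda>y. exp (u \<bullet> y - u \<bullet> S u / 2))"
    by (intro integrableI_nonneg) auto
  then have "integrable N (\<lambda>y. exp (u \<bullet> S u / 2) * exp (u \<bullet> y - u \<bullet> S u / 2))"
    by (rule integrable_mult_right)
  then show ?thesis
    by (simp add: exp_add[symmetric])
qed

lemma integrable_exp_scaled_inner: "integrable N (\<lambda>y. exp (r * (u \<bullet> y)))"
  using integrable_exp_inner[of "r *\<^sub>R u"] by simp

lemma moment_generating: "(\<integral>y. exp (u \<bullet> y) \<partial>N) = exp (u \<bullet> S u / 2)"
proof -
  have "complex_of_real (\<integral>y. exp (u \<bullet> y) \<partial>N) = of_real (exp (u \<bullet> S u / 2))"
    using integral_exp_inner[of "\<lambda>_. 1" u] by (simp add: prob_space flip: integral_complex_of_real)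
  then show ?thesis
    using of_real_eq_iff by blast
qed

text \<open>By \<open>exp x + exp (- x) \<ge> 2\<close>, the moment generating function, which takes equal values at \<open>u\<close> and
  \<open>- u\<close>, is at least one.\<close>

lemma covariance_nonneg: "0 \<le> u \<bullet> S u"
proof -
  have "(\<integral>y. 2 \<partial>N) \<le> (\<integral>y. exp (u \<bullet> y) + exp ((-u) \<bullet> y) \<partial>N)"
  proof (rule integral_mono)
    fix y
    have "u \<bullet> y + 1 \<le> exp (u \<bullet> y)" "- (u \<bullet> y) + 1 \<le> exp (- (u \<bullet> y))"
      using exp_ge_add_one_self[of "u \<bullet> y"] exp_ge_add_one_self[of "- (u \<bullet> y)"] by linarith+
    then show "2 \<le> exp (u \<bullet> y) + exp ((-u) \<bullet> y)"
      by simp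
  qed (intro Bochner_Integration.integrable_add integrable_exp_inner integrable_const)+
  also have "\<dots> = 2 * exp (u \<bullet> S u / 2)"
    unfolding moment_generating Bochner_Integration.integral_add[OF integrable_exp_inner integrable_exp_inner]
    by (simp add: linear_neg[OF linear_S])
  finally have "2 \<le> 2 * exp (u \<bullet> S u / 2)"
    by (simp add: prob_space)
  then show ?thesis
    by simp
qed

text \<open>The moment generating function along the line through \<open>u\<close> extends to an entire function, whose value
  at \<open>\<i>\<close> is the characteristic function.\<close>

lemma characteristic: "(\<integral>y. exp (\<i> * of_real (u \<bullet> y)) \<partial>N) = of_real (exp (- (u \<bullet> S u) / 2))"
proof -
  have "(\<lambda>z. \<integral>y. 1 * exp (z * of_real (u \<bullet> y)) \<partial>N) holomorphic_on UNIV"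
    by (rule exp_integral_entire[where K = 1]) (auto intro: integrable_exp_scaled_inner)
  moreover have "(\<lambda>z. exp (z\<^sup>2 * of_real (u \<bullet> S u) / 2)) holomorphic_on UNIV"
    by (intro holomorphic_intros) auto
  moreover have "(\<integral>y. 1 * exp (complex_of_real r * of_real (u \<bullet> y)) \<partial>N)
      = exp ((of_real r)\<^sup>2 * of_real (u \<bullet> S u) / 2)" for r :: real
    using integral_exp_inner[of "\<lambda>_. 1" "r *\<^sub>R u"]
    by (simp add: prob_space linear_scale[OF linear_S] power2_eq_square exp_of_real[symmetric] ac_simps)
  ultimately have "(\<integral>y. 1 * exp (\<i> * of_real (u \<bullet> y)) \<partial>N) = exp (\<i>\<^sup>2 * of_real (u \<bullet> S u) / 2)"
    by (rule entire_eqI_reals)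
  then show ?thesis
    by (simp add: exp_of_real[symmetric])
qed

text \<open>If \<open>W\<close> is standard normal and independent of \<open>Y\<close>, the left-hand side is the probability of
  \<open>W - a \<bullet> Y \<le> d\<close>. The law \<open>D\<close> of \<open>W - a \<bullet> Y\<close> has the same characteristic function as the law \<open>D'\<close> of
  \<open>s * W\<close>, hence agrees with it. Comparing with \<open>D'\<close> rather than with a normal density of variance
  \<open>a \<bullet> S a\<close> for \<open>a \<bullet> Y\<close> alone also covers the degenerate case \<open>a \<bullet> S a = 0\<close>, because \<open>s \<ge> 1\<close>.\<close>

lemma integral_std_normal_cdf_inner:
  "(\<integral>y. std_normal_cdf (a \<bullet> y + d) \<partial>N) = std_normal_cdf (d / sqrt (1 + a \<bullet> S a))"
proof -
  define s where "s = sqrt (1 + a \<bullet> S a)"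
  have s: "0 < s" "s\<^sup>2 = 1 + a \<bullet> S a"
    using covariance_nonneg[of a] by (auto simp: s_def)
  interpret G: real_distribution std_normal_distribution
    by (rule real_dist_normal_dist)
  interpret GN: pair_prob_space std_normal_distribution N ..
  define D where "D = distr (std_normal_distribution \<Otimes>\<^sub>M N) borel (\<lambda>(w, y). w - a \<bullet> y)"
  define D' where "D' = distr std_normal_distribution borel (\<lambda>w. s * w)"
  have "real_distribution D" "real_distribution D'"
    unfolding D_def D'_def by (intro GN.real_distribution_distr G.real_distribution_distr; measurable)+
  moreover have "char D = char D'"
  proof
    fix r
    have int: "integrable (std_normal_distribution \<Otimes>\<^sub>M N)
        (\<lambda>(w, y). iexp (r * w) * iexp (((- r) *\<^sub>R a) \<bullet> y))"
      by (rule GN.integrable_const_bound[where B = 1]) (auto simp: norm_mult)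
    have "char D r = (\<integral>x. iexp (r * (case x of (w, y) \<Rightarrow> w - a \<bullet> y)) \<partial>(std_normal_distribution \<Otimes>\<^sub>M N))"
      unfolding char_def D_def by (rule integral_distr) measurable
    also have "\<dots> = (\<integral>x. (case x of (w, y) \<Rightarrow> iexp (r * w) * iexp (((- r) *\<^sub>R a) \<bullet> y))
        \<partial>(std_normal_distribution \<Otimes>\<^sub>M N))"
      by (intro Bochner_Integration.integral_cong refl)
        (auto simp: exp_add[symmetric] algebra_simps)
    \<comment> \<open>Independence of \<open>W\<close> and \<open>Y\<close> factorises the characteristic function.\<close>
    also have "\<dots> = (\<integral>w. (\<integral>y. iexp (r * w) * iexp (((- r) *\<^sub>R a) \<bullet> y) \<partial>N) \<partial>std_normal_distribution)"
      by (rule GN.integral_fst[OF int, symmetric])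
    also have "\<dots> = char std_normal_distribution r * (\<integral>y. iexp (((- r) *\<^sub>R a) \<bullet> y) \<partial>N)"
      unfolding char_def by simp
    also have "\<dots> = of_real (exp (- (s * r)\<^sup>2 / 2))"
      unfolding characteristic char_std_normal_distribution power_mult_distrib s(2)
      by (simp add: linear_scale[OF linear_S] linear_neg[OF linear_S] power2_eq_square
          algebra_simps add_divide_distrib diff_divide_distrib flip: of_real_mult exp_add)
    also have "\<dots> = char std_normal_distribution (s * r)"
      by (simp add: char_std_normal_distribution)
    also have "\<dots> = char D' r"
      unfolding char_def D'_def by (subst integral_distr) (auto simp: ac_simps)
    finally show "char D r = char D' r" .
  qed
  ultimately have "D = D'"
    by (rule Levy_uniqueness)
  have "(\<integral>y. std_normal_cdf (a \<bullet> y + d) \<partial>N)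
      = (\<integral>y. (\<integral>w. indicator {..d} (w - a \<bullet> y) \<partial>std_normal_distribution) \<partial>N)"
  proof (intro Bochner_Integration.integral_cong refl)
    fix y
    have "(\<integral>w. indicat_real {..d} (w - a \<bullet> y) \<partial>std_normal_distribution)
        = (\<integral>w. indicator {..a \<bullet> y + d} w \<partial>std_normal_distribution)"
      by (intro Bochner_Integration.integral_cong refl) (auto simp: indicator_def)
    then show "std_normal_cdf (a \<bullet> y + d) = (\<integral>w. indicator {..d} (w - a \<bullet> y) \<partial>std_normal_distribution)"
      by (simp add: std_normal_cdf_def cdf_def)
  qed
  also have "\<dots> = (\<integral>x. (case x of (w, y) \<Rightarrow> indicator {..d} (w - a \<bullet> y)) \<partial>(std_normal_distribution \<Otimes>\<^sub>M N))"
    by (rule GN.integral_snd, rule GN.integrable_const_bound[where B = 1]) (auto simp: indicator_def)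
  also have "\<dots> = (\<integral>x. indicator {..d} x \<partial>D)"
    unfolding D_def by (subst integral_distr) (auto simp: case_prod_unfold)
  also have "\<dots> = (\<integral>x. indicator {..d} (s * x) \<partial>std_normal_distribution)"
    unfolding \<open>D = D'\<close> D'_def by (subst integral_distr) auto
  also have "\<dots> = (\<integral>x. indicator {..d / s} x \<partial>std_normal_distribution)"
    using s(1) by (intro Bochner_Integration.integral_cong refl) (auto simp: indicator_def field_simps)
  also have "\<dots> = std_normal_cdf (d / s)"
    by (simp add: std_normal_cdf_def cdf_def)
  finally show ?thesis
    by (simp add: s_def)
qed

text \<open>For \<open>z\<close> real in place of \<open>\<i>\<close>, the exponential weight turns \<open>Y\<close> into \<open>Y + z S t\<close> and the previous lemma
  evaluates the remaining mean. Both sides are entire in \<open>z\<close>, on the right because \<open>Phi\<close> is; this is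
  where the complex extension of the distribution function comes from.\<close>

theorem integral_std_normal_cdf_iexp:
  "(\<integral>y. of_real (std_normal_cdf (a \<bullet> y)) * exp (\<i> * of_real (t \<bullet> y)) \<partial>N)
    = of_real (exp (- (t \<bullet> S t) / 2)) * Phi (\<i> * of_real (a \<bullet> S t / sqrt (1 + a \<bullet> S a)))"
proof -
  define s where "s = sqrt (1 + a \<bullet> S a)"
  have "(\<lambda>z. \<integral>y. of_real (std_normal_cdf (a \<bullet> y)) * exp (z * of_real (t \<bullet> y)) \<partial>N) holomorphic_on UNIV"
    by (rule exp_integral_entire[where K = 1])
      (auto intro: integrable_exp_scaled_inner simp: std_normal_cdf_nonneg std_normal_cdf_le_1)
  moreover have "(\<lambda>z. exp (z\<^sup>2 * of_real (t \<bullet> S t) / 2) * Phi (z * of_real (a \<bullet> S t / s))) holomorphic_on UNIV"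
    by (intro holomorphic_intros holomorphic_on_compose_gen[OF _ Phi_entire, unfolded o_def]) auto
  moreover have "(\<integral>y. of_real (std_normal_cdf (a \<bullet> y)) * exp (complex_of_real r * of_real (t \<bullet> y)) \<partial>N)
      = exp ((of_real r)\<^sup>2 * of_real (t \<bullet> S t) / 2) * Phi (of_real r * of_real (a \<bullet> S t / s))" for r :: real
  proof -
    have "(\<integral>y. of_real (std_normal_cdf (a \<bullet> y)) * exp (complex_of_real r * of_real (t \<bullet> y)) \<partial>N)
        = (\<integral>y. of_real (std_normal_cdf (a \<bullet> y)) * of_real (exp ((r *\<^sub>R t) \<bullet> y)) \<partial>N)"
      by (simp add: exp_of_real[symmetric])
    also have "\<dots> = of_real (exp ((r *\<^sub>R t) \<bullet> S (r *\<^sub>R t) / 2)) *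
        (\<integral>y. complex_of_real (std_normal_cdf (a \<bullet> y + a \<bullet> S (r *\<^sub>R t))) \<partial>N)"
      by (subst integral_exp_inner) (auto simp: inner_add_right)
    also have "\<dots> = of_real (exp ((r *\<^sub>R t) \<bullet> S (r *\<^sub>R t) / 2)) * Phi (of_real (a \<bullet> S (r *\<^sub>R t) / s))"
      unfolding integral_complex_of_real integral_std_normal_cdf_inner s_def Phi_of_real ..
    also have "\<dots> = exp ((of_real r)\<^sup>2 * of_real (t \<bullet> S t) / 2) * Phi (of_real r * of_real (a \<bullet> S t / s))"
      by (simp add: linear_scale[OF linear_S] power2_eq_square exp_of_real[symmetric] ac_simps)
    finally show ?thesis .
  qed
  ultimately have "(\<integral>y. of_real (std_normal_cdf (a \<bullet> y)) * exp (\<i> * of_real (t \<bullet> y)) \<partial>N)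
      = exp (\<i>\<^sup>2 * of_real (t \<bullet> S t) / 2) * Phi (\<i> * of_real (a \<bullet> S t / s))"
    by (rule entire_eqI_reals)
  then show ?thesis
    by (simp add: exp_of_real[symmetric] s_def)
qed

end


section \<open>Gaussian and skewed densities\<close>

lemma distr_density_lborel_translate:
  fixes f :: "'a::euclidean_space \<Rightarrow> ennreal"
  assumes [measurable]: "f \<in> borel_measurable borel"
  shows "distr (density lborel f) borel (\<lambda>y. y + c) = density lborel (\<lambda>y. f (y - c))"
proof -
  have "distr lborel borel (\<lambda>y. y + c) = lborel"
    using lborel_distr_plus[of c] by (metis (no_types, lifting) add.commute ext)
  moreover have "density (distr lborel borel (\<lambda>y. y + c)) (\<lambda>y. f (y - c))
      = distr (density lborel f) borel (\<lambda>y. y + c)"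
    by (subst density_distr) auto
  ultimately show ?thesis
    by simp
qed

lemma nn_integral_lborel_uminus:
  fixes f :: "'a::euclidean_space \<Rightarrow> ennreal"
  assumes [measurable]: "f \<in> borel_measurable borel"
  shows "(\<integral>\<^sup>+y. f (- y) \<partial>lborel) = (\<integral>\<^sup>+y. f y \<partial>lborel)"
proof -
  have "lborel = distr lborel borel (uminus :: 'a \<Rightarrow> 'a)"
    using lborel_affine[of "-1" "0::'a"] by (simp add: density_1)
  then have "(\<integral>\<^sup>+y. f y \<partial>lborel) = (\<integral>\<^sup>+y. f y \<partial>distr lborel borel (uminus :: 'a \<Rightarrow> 'a))"
    by simp
  also have "\<dots> = (\<integral>\<^sup>+y. f (- y) \<partial>lborel)"
    by (rule nn_integral_distr) auto
  finally show ?thesis ..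
qed

text \<open>Translation invariance of Lebesgue measure turns the pointwise identity for the density into the
  Cameron--Martin formula. For Gaussian densities that identity is completing the square.\<close>

lemma cameron_martin_density:
  fixes \<rho> :: "'a::euclidean_space \<Rightarrow> real"
  assumes [measurable]: "\<rho> \<in> borel_measurable borel"
    and "\<And>y. 0 \<le> \<rho> y" and "(\<integral>\<^sup>+y. \<rho> y \<partial>lborel) = 1" and "linear S"
    and shift: "\<And>y u. \<rho> (y - S u) = \<rho> y * exp (u \<bullet> y - u \<bullet> S u / 2)"
  shows "cameron_martin (density lborel \<rho>) S"
proof (rule cameron_martin.intro, goal_cases)
  case 1
  show ?case
    by (rule prob_spaceI) (simp add: emeasure_density assms(3))
next
  case 2
  show ?case
    by (rule cameron_martin_axioms.intro)
      (auto simp: \<open>linear S\<close> distr_density_lborel_translate shift density_density_eq ennreal_mult assms(2))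
qed

text \<open>Since \<open>std_normal_cdf x + std_normal_cdf (- x) = 1\<close>, the skewed density and its reflection add up to
  \<open>2 * \<rho>\<close>, while each has mass one.\<close>

lemma skew_density_normalised:
  fixes \<rho> :: "'a::euclidean_space \<Rightarrow> real"
  assumes [measurable]: "\<rho> \<in> borel_measurable borel"
    and nonneg: "\<And>y. 0 \<le> \<rho> y" and even: "\<And>y. \<rho> (- y) = \<rho> y"
    and norm: "(\<integral>\<^sup>+y. ennreal (2 * \<rho> y * std_normal_cdf (a \<bullet> y)) \<partial>lborel) = 1"
  shows "(\<integral>\<^sup>+y. ennreal (\<rho> y) \<partial>lborel) = 1"
proof -
  have "(\<integral>\<^sup>+y. ennreal (2 * \<rho> y * std_normal_cdf (a \<bullet> (- y))) \<partial>lborel) = 1"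
    using nn_integral_lborel_uminus[of "\<lambda>y. ennreal (2 * \<rho> y * std_normal_cdf (a \<bullet> y))"] norm
    by (simp add: even)
  with norm have "(\<integral>\<^sup>+y. ennreal (2 * \<rho> y * std_normal_cdf (a \<bullet> y))
      + ennreal (2 * \<rho> y * std_normal_cdf (a \<bullet> (- y))) \<partial>lborel) = 2"
    by (subst nn_integral_add) auto
  also have "(\<lambda>y. ennreal (2 * \<rho> y * std_normal_cdf (a \<bullet> y))
      + ennreal (2 * \<rho> y * std_normal_cdf (a \<bullet> (- y)))) = (\<lambda>y. 2 * ennreal (\<rho> y))"
  proof
    fix y
    have "ennreal (2 * \<rho> y * std_normal_cdf (a \<bullet> y)) + ennreal (2 * \<rho> y * std_normal_cdf (a \<bullet> (- y)))
        = ennreal (2 * \<rho> y * std_normal_cdf (a \<bullet> y) + 2 * \<rho> y * std_normal_cdf (a \<bullet> (- y)))"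
      using nonneg std_normal_cdf_nonneg by (intro ennreal_plus[symmetric]) (auto intro!: mult_nonneg_nonneg)
    also have "2 * \<rho> y * std_normal_cdf (a \<bullet> y) + 2 * \<rho> y * std_normal_cdf (a \<bullet> (- y)) = 2 * \<rho> y"
      by (simp add: std_normal_cdf_uminus algebra_simps)
    finally show "ennreal (2 * \<rho> y * std_normal_cdf (a \<bullet> y)) + ennreal (2 * \<rho> y * std_normal_cdf (a \<bullet> (- y)))
        = 2 * ennreal (\<rho> y)"
      using nonneg[of y] by (simp add: ennreal_mult)
  qed
  finally have "2 * (\<integral>\<^sup>+y. ennreal (\<rho> y) \<partial>lborel) = 2 * 1"
    by (simp add: nn_integral_cmult)
  then show ?thesis
    by (subst (asm) ennreal_mult_cancel_left) auto
qed


section \<open>Column stacking, Kronecker products and inverses\<close>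

lemma vec_cols_inner: "vec_cols (A :: real^'p^'n) \<bullet> vec_cols C = A \<bullet> C"
  unfolding vec_cols_def inner_vec_def
  by (simp add: UNIV_Times_UNIV[symmetric] sum.cartesian_product' del: UNIV_Times_UNIV) (rule sum.swap)

lemma trace_transpose_mult: "trace (transpose A ** C) = (A :: real^'p^'n) \<bullet> C"
proof -
  have "trace (transpose A ** C) = (\<Sum>j\<in>UNIV. \<Sum>i\<in>UNIV. A $ i $ j * C $ i $ j)"
    by (simp add: trace_def matrix_matrix_mult_def transpose_def)
  also have "\<dots> = A \<bullet> C"
    by (subst sum.swap) (simp add: inner_vec_def)
  finally show ?thesis .
qed

lemma vec_cols_linear: "linear (vec_cols :: real^'p^'n \<Rightarrow> _)"
  by (rule linearI) (auto simp: vec_cols_def vec_eq_iff)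

lemma kronecker_mult_vec_cols:
  fixes A :: "real^'m^'n" and X :: "real^'q^'m" and C :: "real^'p^'q"
  shows "(transpose C \<otimes>\<^sub>K A) *v vec_cols X = vec_cols (A ** X ** C)"
  unfolding kronecker_def vec_cols_def matrix_vector_mult_def matrix_matrix_mult_def transpose_def
  by (simp add: vec_eq_iff UNIV_Times_UNIV[symmetric] sum.cartesian_product' sum_distrib_left
      sum_distrib_right del: UNIV_Times_UNIV) (simp add: mult_ac)

lemma kronecker_mult:
  fixes A :: "real^'q^'p" and A' :: "real^'r^'q" and C :: "real^'m^'n" and C' :: "real^'l^'m"
  shows "(A \<otimes>\<^sub>K C) ** (A' \<otimes>\<^sub>K C') = (A ** A') \<otimes>\<^sub>K (C ** C')"
  unfolding kronecker_def matrix_matrix_mult_def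
  by (simp add: vec_eq_iff UNIV_Times_UNIV[symmetric] sum.cartesian_product' sum_product
      del: UNIV_Times_UNIV) (simp add: mult_ac)

lemma kronecker_mat_1: "mat 1 \<otimes>\<^sub>K mat 1 = (mat 1 :: real^('p::finite \<times> 'n::finite)^('p \<times> 'n))"
  by (auto simp: kronecker_def mat_def vec_eq_iff prod_eq_iff)

lemma transpose_kronecker: "transpose (A \<otimes>\<^sub>K C) = transpose A \<otimes>\<^sub>K transpose (C :: 'a::times^'m^'n)"
  by (simp add: kronecker_def transpose_def)

lemma matrix_inv_mult:
  fixes A :: "'a::semiring_1^'n^'m"
  assumes "invertible A"
  shows "A ** matrix_inv A = mat 1" "matrix_inv A ** A = mat 1"
  using someI_ex[OF assms[unfolded invertible_def]] unfolding matrix_inv_def by auto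

lemma matrix_inv_eqI:
  fixes A :: "'a::semiring_1^'n^'m"
  assumes "A ** B = mat 1" "B ** A = mat 1"
  shows "matrix_inv A = B"
proof -
  have "invertible A"
    using assms by (auto simp: invertible_def)
  then have "matrix_inv A = matrix_inv A ** (A ** B)" "matrix_inv A ** A = mat 1"
    by (simp_all add: assms matrix_inv_mult)
  then show ?thesis
    by (simp add: matrix_mul_assoc)
qed

lemma matrix_inv_kronecker:
  fixes A :: "real^'p^'p" and C :: "real^'n^'n"
  assumes "invertible A" "invertible C"
  shows "matrix_inv (A \<otimes>\<^sub>K C) = matrix_inv A \<otimes>\<^sub>K matrix_inv C"
  by (rule matrix_inv_eqI) (simp_all add: kronecker_mult kronecker_mat_1 matrix_inv_mult assms)

lemma transpose_matrix_inv:
  fixes A :: "real^'n^'n"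
  assumes "invertible A"
  shows "transpose (matrix_inv A) = matrix_inv (transpose A)"
  by (rule matrix_inv_eqI[symmetric])
    (simp_all add: matrix_inv_mult assms flip: matrix_transpose_mul)

lemma positive_definite_invertible:
  assumes "positive_definite A"
  shows "invertible A"
proof -
  have "\<forall>x. A *v x = 0 \<longrightarrow> x = 0"
    using assms by (force simp: positive_definite_def)
  then obtain B where "B ** A = mat 1"
    using matrix_left_invertible_ker[of A] by blast
  then show ?thesis
    using matrix_left_right_inverse by (auto simp: invertible_def)
qed

lemma positive_definite_diagonal:
  fixes A :: "real^'n^'n"
  assumes "positive_definite A"
  shows "0 < A $ i $ i"
proof -
  have "axis i 1 \<bullet> (A *v axis i 1) > 0"
    using assms by (auto simp: positive_definite_def axis_eq_0_iff)
  then show ?thesis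
    by (simp add: inner_axis' matrix_vector_mult_basis column_def)
qed

lemma sd_matrix_invertible:
  fixes A :: "real^'n^'n"
  assumes "positive_definite A"
  shows "invertible (sd_matrix A)"
proof -
  define D where "D = diag_matrix (\<chi> i. 1 / sqrt (A $ i $ i))"
  have "A $ i $ i \<noteq> 0" "A $ i $ i \<ge> 0" for i
    using positive_definite_diagonal[OF assms, of i] by auto
  then have "sd_matrix A ** D = mat 1" "D ** sd_matrix A = mat 1"
    by (auto simp: sd_matrix_def D_def diag_matrix_def matrix_matrix_mult_def mat_def vec_eq_iff
        if_distrib[of "\<lambda>x. x * _"] if_distrib[of "\<lambda>x. _ * x"] sum.delta cong: if_cong)
  then show ?thesis
    by (auto simp: invertible_def)
qed

lemma transpose_sd_matrix: "transpose (sd_matrix A) = sd_matrix A"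
  by (auto simp: sd_matrix_def diag_matrix_def transpose_def vec_eq_iff)

lemma etr_i_cmatrix: "etr (\<i> *\<^sub>m cmatrix A) = exp (\<i> * of_real (trace A))"
  by (simp add: etr_def mscale_def cmatrix_def trace_def map_matrix_def sum_distrib_left)

lemma trace_cmatrix: "trace (cmatrix A) = of_real (trace A)"
  by (simp add: cmatrix_def trace_def map_matrix_def)


section \<open>The characteristic function of the matrix variate skew-normal distribution\<close>

text \<open>Under column stacking, \<open>S\<close> in the proof is multiplication by \<open>V \<otimes>\<^sub>K \<Sigma>\<close>, and \<open>a\<close> is the matrix with
  \<open>vec_cols a = matrix_inv (v \<otimes>\<^sub>K \<sigma>) *v vec_cols B\<close>, so that the skewing factor is \<open>std_normal_cdf (a \<bullet> (Z - M))\<close>. In these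
  terms \<open>a \<bullet> S T\<close> and \<open>a \<bullet> S a\<close> are the two traces inside \<open>Phi\<close>.\<close>

theorem theorem3p1:
  fixes P :: "'w measure"
    and Z :: "'w \<Rightarrow> real^'p^'n"
    and M B T :: "real^'p^'n"
    and V v Vbar :: "real^'p^'p"
    and \<Sigma> \<sigma> \<Sigma>bar :: "real^'n^'n"
  assumes "prob_space P"
    and "positive_definite V"
    and "positive_definite \<Sigma>"
    and "skew_normal_distributed P Z M V \<Sigma> B"
    and "v = diag_matrix (\<chi> j. sqrt (V $ j $ j))"
    and "\<sigma> = diag_matrix (\<chi> i. sqrt (\<Sigma> $ i $ i))"
    and "Vbar = matrix_inv v ** V ** matrix_inv v"
    and "\<Sigma>bar = matrix_inv \<sigma> ** \<Sigma> ** matrix_inv \<sigma>"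
  shows "matrix_char P Z T =
    2 * etr (\<i> *\<^sub>m cmatrix (transpose M ** T)
             - cmatrix ((1/2) *\<^sub>R (transpose T ** \<Sigma> ** T ** V)))
      * Phi (\<i> * complex_of_real
          (trace (V ** matrix_inv v ** transpose B ** matrix_inv \<sigma> ** \<Sigma> ** T)
           / sqrt (1 + trace (transpose B ** \<Sigma>bar ** B ** Vbar))))"
proof -
  interpret P: prob_space P by fact
  define q where "q = matrix_inv (V \<otimes>\<^sub>K \<Sigma>)"
  define C where "C = 1 / sqrt ((2 * pi) ^ CARD('p \<times> 'n) * det (V \<otimes>\<^sub>K \<Sigma>))"
  define \<rho> where "\<rho> Y = C * exp (- (vec_cols Y \<bullet> (q *v vec_cols Y)) / 2)" for Y :: "real^'p^'n"
  define S where "S U = \<Sigma> ** U ** V" for U :: "real^'p^'n"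
  define a where "a = matrix_inv \<sigma> ** B ** matrix_inv v"
  define f where "f Y = 2 * \<rho> Y * std_normal_cdf (a \<bullet> Y)" for Y
  have sym: "transpose V = V" "transpose \<Sigma> = \<Sigma>"
    using assms(2,3) by (auto simp: positive_definite_def)
  have inv: "invertible V" "invertible \<Sigma>"
    using assms(2,3) by (auto intro: positive_definite_invertible)
  have sd: "v = sd_matrix V" "\<sigma> = sd_matrix \<Sigma>"
    by (simp_all add: assms(5,6) sd_matrix_def)
  have inv_sd: "invertible v" "invertible \<sigma>"
    unfolding sd using assms(2,3) by (auto intro: sd_matrix_invertible)
  have sym_sd: "transpose (matrix_inv v) = matrix_inv v" "transpose (matrix_inv \<sigma>) = matrix_inv \<sigma>"
    using inv_sd by (simp_all add: transpose_matrix_inv) (simp_all add: sd transpose_sd_matrix)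
  have cov: "q ** (V \<otimes>\<^sub>K \<Sigma>) = mat 1" "transpose q = q"
    unfolding q_def using inv sym
    by (simp_all add: matrix_inv_kronecker kronecker_mult kronecker_mat_1 matrix_inv_mult
        transpose_kronecker transpose_matrix_inv)
  have vec_S: "q *v vec_cols (S U) = vec_cols U" for U
    using kronecker_mult_vec_cols[of V \<Sigma> U] cov(1)
    by (simp add: S_def sym matrix_vector_mul_assoc flip: kronecker_mult_vec_cols)
  have q_sym: "x \<bullet> (q *v y) = (q *v x) \<bullet> y" for x y
    by (metis cov(2) dot_lmul_matrix transpose_matrix_vector)
  have [measurable]: "\<rho> \<in> borel_measurable borel"
    unfolding \<rho>_def
    by (intro borel_measurable_continuous_onI continuous_intros linear_continuous_on
      linear_conv_bounded_linear[THEN iffD1] vec_cols_linear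
      linear_compose[OF vec_cols_linear matrix_vector_mul_linear, unfolded o_def]) auto
  have linear_S: "linear S"
    by (rule linearI) (simp_all add: S_def matrix_matrix_mult_def vec_eq_iff
      sum.distrib sum_distrib_left sum_distrib_right algebra_simps)
  have skew_density: "skew_normal_density M V \<Sigma> B z = f (z - M)" for z
  proof -
    have "matrix_inv (v \<otimes>\<^sub>K \<sigma>) *v vec_cols (z - M) = vec_cols (matrix_inv \<sigma> ** (z - M) ** matrix_inv v)"
      using kronecker_mult_vec_cols[of "matrix_inv v" "matrix_inv \<sigma>" "z - M"]
      by (simp add: matrix_inv_kronecker inv_sd sym_sd)
    moreover have "B \<bullet> (matrix_inv \<sigma> ** (z - M) ** matrix_inv v) = a \<bullet> (z - M)"
      unfolding trace_transpose_mult[symmetric] a_def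
      by (simp add: matrix_transpose_mul sym_sd matrix_mul_assoc trace_mul_sym[of _ "matrix_inv v"])
    ultimately show ?thesis
      by (simp add: skew_normal_density_def matrix_normal_density_def mvnormal_density_def sd vec_cols_inner
         f_def \<rho>_def C_def q_def linear_diff[OF vec_cols_linear] flip: sd)
  qed
  have [measurable]: "f \<in> borel_measurable borel"
    unfolding f_def by measurable
  have Z: "Z \<in> borel_measurable P" and distr_Z: "distr P lborel Z = density lborel (\<lambda>z. ennreal (f (z - M)))"
    using assms(4) by (simp_all add: skew_normal_distributed_def distributed_def skew_density)
  note [measurable] = Z
  have distr_Z': "distr P borel Z = distr (density lborel f) borel (\<lambda>y. y + M)"
    using distr_Z by (simp add: distr_density_lborel_translate cong: distr_cong)
  have norm: "(\<integral>\<^sup>+y. ennreal (f y) \<partial>lborel) = 1"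
  proof -
    have "emeasure (distr P borel Z) UNIV = 1"
      by (simp add: emeasure_distr P.emeasure_space_1)
    then show ?thesis
      unfolding distr_Z' by (simp add: emeasure_distr emeasure_density)
  qed
  \<comment> \<open>A negative constant would make the density, truncated below at zero, vanish identically.\<close>
  have "0 \<le> C"
  proof (rule ccontr)
    assume "\<not> 0 \<le> C"
    then have "f y \<le> 0" for y
      by (auto simp: f_def \<rho>_def std_normal_cdf_nonneg intro!: mult_nonpos_nonneg)
    then have "(\<integral>\<^sup>+y. ennreal (f y) \<partial>lborel) = 0"
      by (simp add: ennreal_neg)
    with norm show False
      by simp
  qed
  then have \<rho>_nonneg: "0 \<le> \<rho> y" for y
    by (simp add: \<rho>_def)
  have "(\<integral>\<^sup>+y. ennreal (\<rho> y) \<partial>lborel) = 1"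
  proof (rule skew_density_normalised)
    show "\<rho> (- y) = \<rho> y" for y
      by (simp add: \<rho>_def linear_neg[OF vec_cols_linear] linear_neg[OF matrix_vector_mul_linear])
  qed (use \<rho>_nonneg norm in \<open>auto simp: f_def\<close>)
  moreover have "\<rho> (y - S u) = \<rho> y * exp (u \<bullet> y - u \<bullet> S u / 2)" for y u
  proof -
    \<comment> \<open>Completing the square: \<open>q\<close> undoes the covariance in the mixed term.\<close>
    have "vec_cols (y - S u) \<bullet> (q *v vec_cols (y - S u))
        = vec_cols y \<bullet> (q *v vec_cols y) - 2 * (u \<bullet> y) + u \<bullet> S u"
      by (simp add: linear_diff[OF vec_cols_linear] matrix_vector_mult_diff_distrib vec_S
        inner_diff_left inner_diff_right q_sym[of "vec_cols (S u)"] vec_cols_inner inner_commute)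
    then show ?thesis
      by (simp add: \<rho>_def flip: exp_add)
  qed
  ultimately interpret N: cameron_martin "density lborel \<rho>" S
    using \<rho>_nonneg linear_S by (intro cameron_martin_density) auto
  have "matrix_char P Z T = (\<integral>w. exp (\<i> * of_real (T \<bullet> Z w)) \<partial>P)"
    by (simp add: matrix_char_def etr_i_cmatrix trace_transpose_mult)
  also have "\<dots> = (\<integral>z. exp (\<i> * of_real (T \<bullet> z)) \<partial>distr P borel Z)"
    by (rule integral_distr[symmetric]) measurable
  also have "\<dots> = (\<integral>y. exp (\<i> * of_real (T \<bullet> (y + M))) \<partial>density lborel f)"
    unfolding distr_Z' by (rule integral_distr) measurable
  also have "\<dots> = (\<integral>y. f y *\<^sub>R exp (\<i> * of_real (T \<bullet> (y + M))) \<partial>lborel)"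
    by (rule integral_density) (auto simp: f_def \<rho>_nonneg std_normal_cdf_nonneg)
  also have "\<dots> = (\<integral>y. 2 * exp (\<i> * of_real (T \<bullet> M)) *
      (\<rho> y *\<^sub>R (of_real (std_normal_cdf (a \<bullet> y)) * exp (\<i> * of_real (T \<bullet> y)))) \<partial>lborel)"
    by (intro Bochner_Integration.integral_cong refl)
      (simp add: f_def scaleR_conv_of_real inner_add_right exp_add distrib_left ac_simps)
  also have "\<dots> = 2 * exp (\<i> * of_real (T \<bullet> M)) *
      (\<integral>y. of_real (std_normal_cdf (a \<bullet> y)) * exp (\<i> * of_real (T \<bullet> y)) \<partial>density lborel \<rho>)"
    unfolding integral_mult_right_zero by (subst integral_density) (auto simp: \<rho>_nonneg)
  also have "\<dots> = 2 * (exp (\<i> * of_real (T \<bullet> M)) * of_real (exp (- (T \<bullet> S T) / 2)))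
      * Phi (\<i> * of_real (a \<bullet> S T / sqrt (1 + a \<bullet> S a)))"
    unfolding N.integral_std_normal_cdf_iexp by simp
  also have "exp (\<i> * of_real (T \<bullet> M)) * of_real (exp (- (T \<bullet> S T) / 2))
      = etr (\<i> *\<^sub>m cmatrix (transpose M ** T) - cmatrix ((1/2) *\<^sub>R (transpose T ** \<Sigma> ** T ** V)))"
  proof -
    have mean_part: "trace (\<i> *\<^sub>m cmatrix (transpose M ** T)) = \<i> * of_real (T \<bullet> M)"
      by (simp add: mscale_def trace_def map_matrix_def sum_distrib_left[symmetric])
        (simp add: cmatrix_def map_matrix_def trace_transpose_mult[unfolded trace_def] inner_commute
          flip: of_real_sum)
    have variance_part: "trace ((1/2) *\<^sub>R (transpose T ** \<Sigma> ** T ** V)) = (T \<bullet> S T) / 2"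
      unfolding trace_transpose_mult[symmetric] S_def
      by (simp add: trace_def matrix_mul_assoc sum_divide_distrib)
    show ?thesis
      unfolding etr_def trace_sub trace_cmatrix mean_part variance_part
      by (simp flip: exp_of_real exp_add)
  qed
  also have "a \<bullet> S T = trace (V ** matrix_inv v ** transpose B ** matrix_inv \<sigma> ** \<Sigma> ** T)"
    unfolding trace_transpose_mult[symmetric] a_def S_def
    by (simp add: matrix_transpose_mul sym_sd matrix_mul_assoc trace_mul_sym[of _ V])
  also have "a \<bullet> S a = trace (transpose B ** \<Sigma>bar ** B ** Vbar)"
    unfolding trace_transpose_mult[symmetric] a_def S_def assms(7,8)
    by (simp add: matrix_transpose_mul sym_sd matrix_mul_assoc trace_mul_sym[of _ "matrix_inv v"])
  finally show ?thesis .
qed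

end
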